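(* Let $\mu$ be a Radon measure on $\mathbb{R}^n$, $1\le p<\infty$, and suppose that either $\gamma>0$, or $\gamma<0$ and in addition $\mu$ is doubling. For $f\in L^1_{\rm loc}(\mathbb{R}^n,\mu)$ set, for $Q\in\mathcal{D}$, $$a(f)_Q=\ell(Q)^{\gamma/p}\frac1{\mu(Q)}\int_Qf\,d\mu\ \text{ if }\mu(Q)>0,\qquad a(f)_Q=0\ \text{ otherwise}.$$ Then there is a constant $C$ independent of $f$ such that $$\|f\|_{L^p(\mathbb{R}^n,\mu)}\le C\,[a(f)]_{l^{p,\infty}_\gamma(\mathbb{R}^n,\mu)}.$$
   Context: $\mathcal{D}$ is the collection of half-open dyadic cubes $[j_12^k,(j_1+1)2^k)\times\cdots\times[j_n2^k,(j_n+1)2^k)$, $k\in\mathbb{Z}$, $j\in\mathbb{Z}^n$; $\ell(Q)$ is the sidelength. $\mu$ is doubling if there is a constant $C_D$ with $0<\mu(2B)\le C_D\,\mu(B)$ for all balls $B$, where $2B$ is the ball with the same center and twice the radius. For a sequence $a=\{a_Q\}_{Q\in\mathcal{D}}$, $$[a]_{l^{p,\infty}_\gamma(\mathbb{R}^n,\mu)}=\Big(\liminf_{\lambda\to0^+}\lambda^p\sum_{Q\in\mathcal{D},\,|a_Q|>\lambda}\ell(Q)^{-\gamma}\mu(Q)\Big)^{1/p}\quad\text{if }\gamma>0,$$ $$[a]_{l^{p,\infty}_\gamma(\mathbb{R}^n,\mu)}=\Big(\limsup_{\lambda\to\infty}\lambda^p\sum_{Q\in\mathcal{D},\,|a_Q|>\lambda}\ell(Q)^{-\gamma}\mu(Q)\Big)^{1/p}\quad\text{if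 }\gamma<0.$$ *)

theory Defs
  imports "HOL-Analysis.Analysis"
begin

subsection \<open>Dyadic cubes\<close>

definition dyadic_cube :: "int \<Rightarrow> int ^ 'n \<Rightarrow> (real ^ 'n) set" where
  "dyadic_cube k j =
     {x. \<forall>i. of_int (j $ i) * 2 powi k \<le> x $ i \<and> x $ i < (of_int (j $ i) + 1) * 2 powi k}"

definition dyadic_cubes :: "(real ^ 'n) set set" where
  "dyadic_cubes = {dyadic_cube k j | k j. True}"

definition sidelength :: "(real ^ 'n) set \<Rightarrow> real" where
  "sidelength Q = (THE l. \<exists>k j. Q = dyadic_cube k j \<and> l = 2 powi k)"

lemma dyadic_cube_eq_imp_le:
  fixes j j' :: "int ^ 'n"
  assumes eq: "dyadic_cube k j = dyadic_cube k' j'"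
  shows "(2 powi k :: real) \<le> 2 powi k'"
proof (rule ccontr)
  assume "\<not> ?thesis"
  then have lt: "(2 powi k' :: real) < 2 powi k" by simp
  have pos: "(2 powi k :: real) > 0" "(2 powi k' :: real) > 0" by auto
  define c :: "real ^ 'n" where "c = (\<chi> i. of_int (j $ i) * 2 powi k)"
  define c' :: "real ^ 'n" where "c' = (\<chi> i. of_int (j' $ i) * 2 powi k')"
  have "c \<in> dyadic_cube k j" "c' \<in> dyadic_cube k' j'"
    using pos by (auto simp: dyadic_cube_def c_def c'_def algebra_simps)
  then have "c \<in> dyadic_cube k' j'" "c' \<in> dyadic_cube k j"
    using eq by auto
  then have cc: "of_int (j $ i) * (2 powi k :: real) = of_int (j' $ i) * 2 powi k'" for i
    by (force simp: dyadic_cube_def c_def c'_def intro: antisym)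
  define d :: "real ^ 'n" where "d = (\<chi> i. of_int (j $ i) * 2 powi k + 2 powi k')"
  have "d \<in> dyadic_cube k j"
    using pos lt by (auto simp: dyadic_cube_def d_def algebra_simps)
  then have "d \<in> dyadic_cube k' j'" using eq by simp
  then show False
    by (auto simp: dyadic_cube_def d_def cc algebra_simps)
qed

lemma sidelength_dyadic_cube: "sidelength (dyadic_cube k j) = 2 powi k"
  unfolding sidelength_def
  by (rule the_equality) (auto intro!: antisym dyadic_cube_eq_imp_le)

subsection \<open>Measures and function spaces\<close>

definition radon_measure :: "('a :: topological_space) measure \<Rightarrow> bool" where
  "radon_measure \<mu> \<longleftrightarrow>
     sets \<mu> = sets borel \<and>
     (\<forall>K. compact K \<longrightarrow> emeasure \<mu> K < \<infinity>) \<and>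
     (\<forall>B\<in>sets borel. emeasure \<mu> B = (INF U\<in>{U. open U \<and> B \<subseteq> U}. emeasure \<mu> U)) \<and>
     (\<forall>U. open U \<longrightarrow> emeasure \<mu> U = (SUP K\<in>{K. compact K \<and> K \<subseteq> U}. emeasure \<mu> K))"

definition doubling_measure :: "('a :: metric_space) measure \<Rightarrow> bool" where
  "doubling_measure \<mu> \<longleftrightarrow>
     (\<exists>C::real. \<forall>x. \<forall>r>0.
        0 < emeasure \<mu> (ball x (2 * r)) \<and>
        emeasure \<mu> (ball x (2 * r)) \<le> ennreal C * emeasure \<mu> (ball x r))"

text \<open>Functions are Borel measurable representatives.\<close>

definition L1_loc :: "('a :: topological_space) measure \<Rightarrow> ('a \<Rightarrow> complex) set" where
  "L1_loc \<mu> = {f \<in> borel_measurable \<mu>. \<forall>K. compact K \<longrightarrow> set_integrable \<mu> K f}"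

text \<open>Real powers of extended nonnegative reals, for positive exponents only.\<close>

definition ennreal_powr :: "ennreal \<Rightarrow> real \<Rightarrow> ennreal" where
  "ennreal_powr x r = (if x = \<infinity> then \<infinity> else ennreal (enn2real x powr r))"

definition Lp_norm :: "real \<Rightarrow> 'a measure \<Rightarrow> ('a \<Rightarrow> complex) \<Rightarrow> ennreal" where
  "Lp_norm p \<mu> f = ennreal_powr (\<integral>\<^sup>+ x. ennreal (norm (f x) powr p) \<partial>\<mu>) (1 / p)"

subsection \<open>Sequences indexed by dyadic cubes\<close>

definition level_sum ::
    "real \<Rightarrow> (real ^ 'n) measure \<Rightarrow> ((real ^ 'n) set \<Rightarrow> complex) \<Rightarrow> real \<Rightarrow> ennreal" where
  "level_sum \<gamma> \<mu> a t =
     (\<Sum>\<^sub>\<infinity> Q\<in>{Q\<in>dyadic_cubes. norm (a Q) > t}. ennreal (sidelength Q powr (- \<gamma>)) * emeasure \<mu> Q)"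

text \<open>Only meant for \<^term>\<open>\<gamma> \<noteq> 0\<close>; the second branch is the case \<^term>\<open>\<gamma> < 0\<close>.\<close>

definition weak_lp_limit ::
    "real \<Rightarrow> real \<Rightarrow> (real ^ 'n) measure \<Rightarrow> ((real ^ 'n) set \<Rightarrow> complex) \<Rightarrow> ennreal" where
  "weak_lp_limit p \<gamma> \<mu> a =
     (if \<gamma> > 0
      then ennreal_powr (Liminf (at_right 0) (\<lambda>t. ennreal (t powr p) * level_sum \<gamma> \<mu> a t)) (1 / p)
      else ennreal_powr (Limsup at_top (\<lambda>t. ennreal (t powr p) * level_sum \<gamma> \<mu> a t)) (1 / p))"

definition dyadic_average_seq ::
    "real \<Rightarrow> real \<Rightarrow> (real ^ 'n) measure \<Rightarrow> (real ^ 'n \<Rightarrow> complex) \<Rightarrow> (real ^ 'n) set \<Rightarrow> complex" where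
  "dyadic_average_seq p \<gamma> \<mu> f Q =
     (if emeasure \<mu> Q > 0
      then of_real (sidelength Q powr (\<gamma> / p)) * (1 / of_real (measure \<mu> Q)) * (LINT x:Q|\<mu>. f x)
      else 0)"

end

theory Submission
  imports Defs
begin

text \<open>
  Put \<open>s = \<gamma> / p\<close>. At a point \<open>x\<close> with \<open>f x \<noteq> 0\<close> there is a scale \<open>k\<close> for which \<open>2 powr (k * s)\<close>
  exceeds \<open>2 * t / norm (f x)\<close> by at most a factor \<open>2 powr \<bar>s\<bar>\<close>. If the average of \<open>f\<close> over the cube \<open>Q\<close> of
  sidelength \<open>2 powi k\<close> around \<open>x\<close> is larger than \<open>norm (f x) / 2\<close>, then \<open>Q\<close> is counted at level \<open>t\<close>, and
  its weight \<open>t powr p * 2 powr (- k * \<gamma>)\<close> alone is at least a constant times \<open>norm (f x) powr p\<close>.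
  As \<open>t \<rightarrow> 0\<close> (for \<open>\<gamma> > 0\<close>) or \<open>t \<rightarrow> \<infinity>\<close> (for \<open>\<gamma> < 0\<close>) one has \<open>k \<rightarrow> -\<infinity>\<close>. Where \<open>norm (f x)\<close> stays
  between \<open>1 / N\<close> and \<open>N\<close>, the scale \<open>k\<close> takes a number of values that is bounded independently of \<open>t\<close>,
  so convergence in the mean of the dyadic averages (rather than almost everywhere) shows that the
  points with a small average are negligible in the limit. Finally \<open>N \<rightarrow> \<infinity>\<close>.
\<close>

subsection \<open>Geometry of the dyadic cubes\<close>

text \<open>Membership in a cube of scale \<open>k\<close> becomes an equation between indices, so
  the cubes of one scale are visibly a partition indexed by a countable type.\<close>

definition dyadic_index :: "int \<Rightarrow> real ^ 'n \<Rightarrow> int ^ 'n" where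
  "dyadic_index k x = (\<chi> i. \<lfloor>x $ i / 2 powi k\<rfloor>)"

lemma mem_dyadic_cube_iff: "x \<in> dyadic_cube k j \<longleftrightarrow> dyadic_index k x = j"
proof -
  have pos: "(2 powi k :: real) > 0" by simp
  show ?thesis
    unfolding dyadic_cube_def dyadic_index_def mem_Collect_eq vec_eq_iff vec_lambda_beta floor_eq_iff
    using pos by (simp add: pos_le_divide_eq pos_divide_less_eq)
qed

lemma dyadic_cube_measurable [measurable]: "dyadic_cube k j \<in> sets borel"
proof -
  have "dyadic_cube k j = (\<Inter>i. {x. of_int (j $ i) * 2 powi k \<le> x $ i} \<inter> {x. x $ i < (of_int (j $ i) + 1) * 2 powi k})"
    by (auto simp: dyadic_cube_def)
  also have "\<dots> \<in> sets borel"
    by (intro sets.countable_INT'' sets.Int borel_closed borel_open)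
       (auto intro!: closed_Collect_le open_Collect_less continuous_intros)
  finally show ?thesis .
qed

lemma measurable_dyadic_index [measurable]:
  "(dyadic_index k :: real ^ 'n \<Rightarrow> int ^ 'n) \<in> borel \<rightarrow>\<^sub>M count_space UNIV"
proof -
  have "dyadic_index k -` {j} = dyadic_cube k j" for j :: "int ^ 'n"
    by (auto simp: mem_dyadic_cube_iff)
  then show ?thesis
    by (subst measurable_count_space_eq2_countable) auto
qed

lemma countable_dyadic_cubes: "countable (dyadic_cubes :: (real ^ 'n) set set)"
proof -
  have "dyadic_cubes = range (\<lambda>(k, j :: int ^ 'n). dyadic_cube k j)"
    by (auto simp: dyadic_cubes_def)
  then show ?thesis
    by (metis countable_image countableI_type)
qed

text \<open>The coarser index is a function of the finer one: dividing by a further power of 2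
  before taking the floor amounts to integer division of the floor. Nestedness of the cubes
  follows.\<close>

lemma dyadic_index_mono:
  assumes eq: "dyadic_index k x = dyadic_index k y" and "k \<le> k'"
  shows "dyadic_index k' x = dyadic_index k' y"
proof -
  have "\<lfloor>z / 2 powi k'\<rfloor> = \<lfloor>z / 2 powi k\<rfloor> div 2 ^ nat (k' - k)" for z :: real
  proof -
    have "z / 2 powi k' = z / 2 powi k / real_of_int (2 ^ nat (k' - k))"
      using \<open>k \<le> k'\<close> by (simp add: power_int_diff flip: power_int_of_nat)
    then show ?thesis
      by (simp only: floor_divide_real_eq_div zero_le_power zero_le_numeral)
  qed
  then show ?thesis
    using eq by (simp add: dyadic_index_def vec_eq_iff)
qed

lemma dyadic_cube_nested:
  assumes "k \<le> k'" "x \<in> dyadic_cube k j" "x \<in> dyadic_cube k' j'"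
  shows "dyadic_cube k j \<subseteq> dyadic_cube k' j'"
  using assms by (auto simp: mem_dyadic_cube_iff dest: dyadic_index_mono[OF _ assms(1)])

text \<open>Two dyadic cubes are nested or disjoint; the empty set is added for the disjoint case.
  With \<open>borel_eq_dyadic_cubes\<close> this permits Dynkin induction over Borel sets.\<close>

lemma Int_stable_dyadic_cubes: "Int_stable (insert {} dyadic_cubes)"
proof -
  have *: "dyadic_cube k j \<inter> dyadic_cube k' j' \<in> {{}, dyadic_cube k j}" if "k \<le> k'"
    for k k' and j j' :: "int ^ 'n"
    using dyadic_cube_nested[OF that] by blast
  have "dyadic_cube k j \<inter> dyadic_cube k' j' \<in> {{}, dyadic_cube k j, dyadic_cube k' j'}"
    for k k' and j j' :: "int ^ 'n"
    using *[of k k' j j'] *[of k' k j' j] by (cases "k \<le> k'") (auto simp: Int_commute)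
  then show ?thesis
    unfolding Int_stable_def dyadic_cubes_def by blast
qed

lemma exists_small_dyadic_cube:
  fixes x :: "real ^ 'n"
  assumes "r > 0"
  obtains k where "dyadic_cube k (dyadic_index k x) \<subseteq> ball x r"
proof -
  \<comment> \<open>The Euclidean distance is at most the sum of the \<open>CARD('n)\<close>
    coordinate distances, each of which is below \<open>2 powi k\<close>.\<close>
  obtain m :: nat where m: "(1/2) ^ m < r / CARD('n)"
    using real_arch_pow_inv[of "r / CARD('n)" "1/2"] assms by auto
  define k where "k = - int m"
  have k: "(2 powi k :: real) < r / CARD('n)"
    using m by (simp add: k_def power_int_minus power_one_over field_simps)
  have "y \<in> ball x r" if "y \<in> dyadic_cube k (dyadic_index k x)" for y
  proof -
    have "x \<in> dyadic_cube k (dyadic_index k x)" by (simp add: mem_dyadic_cube_iff)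
    then have "\<bar>(x - y) $ i\<bar> < 2 powi k" for i
      using that by (auto simp: dyadic_cube_def algebra_simps abs_less_iff) (smt (verit))+
    then have "(\<Sum>i\<in>UNIV. \<bar>(x - y) $ i\<bar>) < (\<Sum>i\<in>(UNIV :: 'n set). 2 powi k)"
      by (intro sum_strict_mono) auto
    also have "\<dots> < r" using k by (simp add: field_simps)
    finally show ?thesis
      using norm_le_l1_cart[of "x - y"] by (simp add: dist_norm)
  qed
  then show ?thesis using that by blast
qed

text \<open>An open set is the union of the dyadic cubes inside it, and there are only countably
  many cubes.\<close>

lemma borel_eq_dyadic_cubes: "(borel :: (real ^ 'n) measure) = sigma UNIV (insert {} dyadic_cubes)"
proof -
  have "(borel :: (real ^ 'n) measure) = sigma UNIV ((\<lambda>Q. Q) ` insert {} dyadic_cubes)"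
  proof (rule borel_eq_sigmaI1[OF borel_def])
  fix U :: "(real ^ 'n) set"
  assume "U \<in> {S. open S}"
  then have "open U" by simp
  have "U = \<Union> {Q \<in> dyadic_cubes. Q \<subseteq> U}"
  proof (intro equalityI subsetI)
    fix x assume "x \<in> U"
    then obtain r where r: "r > 0" "ball x r \<subseteq> U"
      using \<open>open U\<close> open_contains_ball by blast
    obtain k where "dyadic_cube k (dyadic_index k x) \<subseteq> ball x r"
      using exists_small_dyadic_cube[OF r(1)] .
    with r have "dyadic_cube k (dyadic_index k x) \<subseteq> U" by blast
    moreover have "x \<in> dyadic_cube k (dyadic_index k x)" by (simp add: mem_dyadic_cube_iff)
    ultimately show "x \<in> \<Union> {Q \<in> dyadic_cubes. Q \<subseteq> U}"
      by (auto simp: dyadic_cubes_def)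
  qed auto
  also have "\<dots> \<in> sets (sigma UNIV (insert {} dyadic_cubes))"
    by (intro sets.countable_Union countable_subset[OF _ countable_dyadic_cubes]) (auto intro: sigma_sets.Basic)
  finally show "U \<in> sets (sigma UNIV ((\<lambda>x. x) ` insert {} dyadic_cubes))" by simp
qed (auto simp: dyadic_cubes_def)
  then show ?thesis by simp
qed

subsection \<open>Convergence of dyadic averages in the mean\<close>

text \<open>For a finite measure this is the conditional expectation of \<open>f\<close> given the
  cubes of scale \<open>k\<close>. On a null cube the division by zero yields 0, the default value
  of \<open>dyadic_average_seq\<close>.\<close>

definition cube_average ::
    "(real ^ 'n) measure \<Rightarrow> int \<Rightarrow> (real ^ 'n \<Rightarrow> 'b :: {banach, second_countable_topology}) \<Rightarrow> real ^ 'n \<Rightarrow> 'b" where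
  "cube_average M k f x =
     (1 / measure M (dyadic_cube k (dyadic_index k x))) *\<^sub>R (LINT y:dyadic_cube k (dyadic_index k x)|M. f y)"

definition mean_deviation ::
    "(real ^ 'n) measure \<Rightarrow> int \<Rightarrow> (real ^ 'n \<Rightarrow> 'b :: {banach, second_countable_topology}) \<Rightarrow> ennreal" where
  "mean_deviation M k f = (\<integral>\<^sup>+x. norm (f x - cube_average M k f x) \<partial>M)"

text \<open>Finiteness makes constants and indicators of Borel sets integrable. The locale is later
  entered with the restriction of \<open>\<mu>\<close> to a bounded box.\<close>

locale finite_borel_measure = finite_measure M for M :: "(real ^ 'n) measure" +
  assumes sets_M [measurable_cong, simp]: "sets M = sets borel"
begin

lemma space_M [simp]: "space M = UNIV"
  using sets_eq_imp_space_eq[OF sets_M] by simp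

lemma measurable_cube_average [measurable]: "cube_average M k f \<in> borel_measurable M"
proof -
  have "(\<lambda>x. (\<lambda>j. (1 / measure M (dyadic_cube k j)) *\<^sub>R (LINT y:dyadic_cube k j|M. f y)) (dyadic_index k x))
          \<in> borel_measurable M"
    by (rule measurable_compose[of _ _ "count_space UNIV"]) measurable
  then show ?thesis by (simp add: cube_average_def[abs_def])
qed

text \<open>Tonelli for the partition into cubes of scale \<open>k\<close>; estimates on averages
  can then be checked one cube at a time.\<close>

lemma nn_integral_dyadic_split:
  fixes h :: "real ^ 'n \<Rightarrow> ennreal"
  assumes [measurable]: "h \<in> borel_measurable M"
  shows "(\<integral>\<^sup>+x. h x \<partial>M) =
           (\<integral>\<^sup>+j. (\<integral>\<^sup>+x. h x * indicator (dyadic_cube k j) x \<partial>M) \<partial>count_space UNIV)"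
proof -
  have "(\<integral>\<^sup>+j. h x * indicator (dyadic_cube k j) x \<partial>count_space UNIV) = h x" for x
    by (subst nn_integral_count_space'[where A = "{dyadic_index k x}"])
       (auto simp: indicator_def mem_dyadic_cube_iff)
  then have "(\<integral>\<^sup>+x. h x \<partial>M) =
      (\<integral>\<^sup>+x. (\<integral>\<^sup>+j. h x * indicator (dyadic_cube k j) x \<partial>count_space UNIV) \<partial>M)"
    by simp
  also have "\<dots> = (\<integral>\<^sup>+j. (\<integral>\<^sup>+x. h x * indicator (dyadic_cube k j) x \<partial>M) \<partial>count_space UNIV)"
    by (rule nn_integral_count_space_nn_integral) auto
  finally show ?thesis .
qed

lemma set_integrable_dyadic_cube:
  fixes f :: "real ^ 'n \<Rightarrow> 'b :: {banach, second_countable_topology}"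
  shows "integrable M f \<Longrightarrow> set_integrable M (dyadic_cube k j) f"
  unfolding set_integrable_def by (intro integrable_mult_indicator) auto

text \<open>Averaging is a contraction in L1: on a cube the average is constant, and integrating it
  there cancels the division by the measure of the cube.\<close>

lemma nn_integral_norm_cube_average_le:
  assumes f: "integrable M f"
  shows "(\<integral>\<^sup>+x. norm (cube_average M k f x) \<partial>M) \<le> (\<integral>\<^sup>+x. norm (f x) \<partial>M)"
proof -
  note [measurable] = borel_measurable_integrable[OF f]
  have "(\<integral>\<^sup>+x. ennreal (norm (cube_average M k f x)) * indicator (dyadic_cube k j) x \<partial>M) \<le>
          (\<integral>\<^sup>+x. ennreal (norm (f x)) * indicator (dyadic_cube k j) x \<partial>M)" for j
  proof -
    let ?Q = "dyadic_cube k j" and ?I = "LINT y:dyadic_cube k j|M. f y"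
    have "(\<integral>\<^sup>+x. ennreal (norm (cube_average M k f x)) * indicator ?Q x \<partial>M) =
        (\<integral>\<^sup>+x. ennreal (norm ?I / measure M ?Q) * indicator ?Q x \<partial>M)"
      by (intro nn_integral_cong) (auto simp: indicator_def mem_dyadic_cube_iff cube_average_def)
    also have "\<dots> = ennreal (norm ?I / measure M ?Q) * ennreal (measure M ?Q)"
      by (simp add: nn_integral_cmult_indicator emeasure_eq_measure)
    \<comment> \<open>An equality unless the cube is null, where the left side is 0 by
      convention.\<close>
    also have "\<dots> \<le> ennreal (norm ?I)"
      by (subst ennreal_mult'[symmetric]) (auto intro!: ennreal_leI)
    also have "\<dots> \<le> (\<integral>\<^sup>+x. norm (indicator ?Q x *\<^sub>R f x) \<partial>M)"
      unfolding set_lebesgue_integral_def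
      using set_integrable_dyadic_cube[OF f] 
      by (intro integral_norm_bound_ennreal) (simp add: set_integrable_def)
    also have "\<dots> = (\<integral>\<^sup>+x. ennreal (norm (f x)) * indicator ?Q x \<partial>M)"
      by (intro nn_integral_cong) (auto simp: indicator_def)
    finally show ?thesis .
  qed
  then show ?thesis
    by (subst (1 2) nn_integral_dyadic_split[where k = k]) (simp_all add: nn_integral_mono)
qed

lemma cube_average_add:
  assumes "integrable M f" "integrable M g"
  shows "cube_average M k (\<lambda>x. f x + g x) x = cube_average M k f x + cube_average M k g x"
  using assms by (simp add: cube_average_def set_integral_add set_integrable_dyadic_cube scaleR_add_right)

lemma mean_deviation_add_le:
  assumes f: "integrable M f" and g: "integrable M g"
  shows "mean_deviation M k (\<lambda>x. f x + g x) \<le> mean_deviation M k f + mean_deviation M k g"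
proof -
  note [measurable] = borel_measurable_integrable[OF f] borel_measurable_integrable[OF g]
  have "norm (f x + g x - cube_average M k (\<lambda>x. f x + g x) x) \<le>
      norm (f x - cube_average M k f x) + norm (g x - cube_average M k g x)" for x
    using cube_average_add[OF f g, of k x]
      norm_triangle_ineq[of "f x - cube_average M k f x" "g x - cube_average M k g x"]
    by (simp add: algebra_simps)
  then have "mean_deviation M k (\<lambda>x. f x + g x) \<le>
      (\<integral>\<^sup>+x. ennreal (norm (f x - cube_average M k f x)) + ennreal (norm (g x - cube_average M k g x)) \<partial>M)"
    unfolding mean_deviation_def
    by (intro nn_integral_mono) (simp flip: ennreal_plus add: ennreal_leI)
  also have "\<dots> = mean_deviation M k f + mean_deviation M k g"
    unfolding mean_deviation_def by (rule nn_integral_add) auto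
  finally show ?thesis .
qed

text \<open>The bound is uniform in \<open>k\<close>, which lets an L1 approximation carry
  convergence of the deviations over to the limit function.\<close>

lemma mean_deviation_le:
  assumes f: "integrable M f"
  shows "mean_deviation M k f \<le> 2 * (\<integral>\<^sup>+x. norm (f x) \<partial>M)"
proof -
  note [measurable] = borel_measurable_integrable[OF f]
  have "mean_deviation M k f \<le> (\<integral>\<^sup>+x. ennreal (norm (f x)) + ennreal (norm (cube_average M k f x)) \<partial>M)"
    unfolding mean_deviation_def
    by (intro nn_integral_mono) (simp flip: ennreal_plus add: ennreal_leI norm_triangle_ineq4)
  also have "\<dots> = (\<integral>\<^sup>+x. norm (f x) \<partial>M) + (\<integral>\<^sup>+x. norm (cube_average M k f x) \<partial>M)"
    by (rule nn_integral_add) auto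
  also have "\<dots> \<le> (\<integral>\<^sup>+x. norm (f x) \<partial>M) + (\<integral>\<^sup>+x. norm (f x) \<partial>M)"
    by (intro add_left_mono nn_integral_norm_cube_average_le f)
  finally show ?thesis by (simp add: mult_2)
qed

lemma mean_deviation_tendsto_add:
  assumes "integrable M f" "integrable M g"
    and "((\<lambda>k. mean_deviation M k f) \<longlongrightarrow> 0) F" "((\<lambda>k. mean_deviation M k g) \<longlongrightarrow> 0) F"
  shows "((\<lambda>k. mean_deviation M k (\<lambda>x. f x + g x)) \<longlongrightarrow> 0) F"
proof (rule tendsto_sandwich[OF _ _ tendsto_const])
  show "((\<lambda>k. mean_deviation M k f + mean_deviation M k g) \<longlongrightarrow> 0) F"
    using tendsto_add[OF assms(3,4)] by simp
qed (use mean_deviation_add_le[OF assms(1,2)] in simp_all)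

lemma mean_deviation_tendsto_limit:
  assumes f: "integrable M f" and s: "\<And>n. integrable M (s n)"
    and lim: "(\<lambda>n. \<integral>\<^sup>+x. norm (f x - s n x) \<partial>M) \<longlonglongrightarrow> 0"
    and dev: "\<And>n. ((\<lambda>k. mean_deviation M k (s n)) \<longlongrightarrow> 0) F"
  shows "((\<lambda>k. mean_deviation M k f) \<longlongrightarrow> 0) F"
proof (rule tendsto_zero_ennreal)
  fix r :: real assume "r > 0"
  \<comment> \<open>The share is \<open>r / 4\<close> because \<open>mean_deviation_le\<close>
    doubles the L1 error; the other \<open>r / 2\<close> goes to \<open>s n\<close>.\<close>
  then have "eventually (\<lambda>n. (\<integral>\<^sup>+x. norm (f x - s n x) \<partial>M) < ennreal (r / 4)) sequentially"
    by (intro order_tendstoD(2)[OF lim]) auto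
  then obtain n where n: "(\<integral>\<^sup>+x. norm (f x - s n x) \<partial>M) < ennreal (r / 4)"
    by (auto simp: eventually_sequentially)
  have "eventually (\<lambda>k. mean_deviation M k (s n) < ennreal (r / 2)) F"
    using \<open>r > 0\<close> by (intro order_tendstoD(2)[OF dev]) auto
  then show "eventually (\<lambda>k. mean_deviation M k f < ennreal r) F"
  proof eventually_elim
    case (elim k)
    have "mean_deviation M k f = mean_deviation M k (\<lambda>x. (f x - s n x) + s n x)"
      by simp
    also have "\<dots> \<le> mean_deviation M k (\<lambda>x. f x - s n x) + mean_deviation M k (s n)"
      using f s by (intro mean_deviation_add_le) auto
    also have "\<dots> \<le> 2 * ennreal (r / 4) + mean_deviation M k (s n)"
      using f s n
      by (intro add_right_mono order.trans[OF mean_deviation_le] mult_left_mono) auto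
    also have "\<dots> < 2 * ennreal (r / 4) + ennreal (r / 2)"
      using elim by (simp add: ennreal_add_left_cancel_less ennreal_mult_eq_top_iff)
    also have "\<dots> = ennreal r"
      using \<open>r > 0\<close> by (simp flip: ennreal_numeral ennreal_mult ennreal_plus)
    finally show ?case .
  qed
qed

text \<open>A cube of scale \<open>k\<close> that meets \<open>A\<close> lies in \<open>A\<close>.
  So the function is constant on each cube and agrees there with its average, except on null cubes,
  which contribute nothing.\<close>

lemma mean_deviation_indicator_saturated:
  assumes A: "A \<in> sets M"
    and sat: "\<And>x. x \<in> A \<Longrightarrow> dyadic_cube k (dyadic_index k x) \<subseteq> A"
  shows "mean_deviation M k (\<lambda>x. indicator A x *\<^sub>R c) = 0"
proof -
  let ?f = "\<lambda>x. indicator A x *\<^sub>R c"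
  have [measurable]: "A \<in> sets borel" using A by simp
  have "(\<integral>\<^sup>+x. ennreal (norm (?f x - cube_average M k ?f x)) * indicator (dyadic_cube k j) x \<partial>M) = 0" for j
  proof (cases "measure M (dyadic_cube k j) = 0")
    case True
    then have "dyadic_cube k j \<in> null_sets M"
      by (intro null_setsI) (auto simp: emeasure_eq_measure)
    then show ?thesis by (rule nn_integral_null_set)
  next
    case False
    have "cube_average M k ?f x = ?f x" if x: "x \<in> dyadic_cube k j" for x
    proof -
      have j: "dyadic_index k x = j" using x by (simp add: mem_dyadic_cube_iff)
      have "(LINT y:dyadic_cube k j|M. ?f y) = (LINT y:dyadic_cube k j|M. ?f x)"
      proof (rule set_lebesgue_integral_cong)
        show "\<forall>y. y \<in> dyadic_cube k j \<longrightarrow> ?f y = ?f x"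
          using sat j x by (fastforce simp: indicator_def mem_dyadic_cube_iff)
      qed simp
      also have "\<dots> = measure M (dyadic_cube k j) *\<^sub>R ?f x"
        unfolding set_lebesgue_integral_def
        by (subst integral_scaleR_left) (auto simp: emeasure_eq_measure)
      finally show ?thesis using False by (simp add: cube_average_def j)
    qed
    then have "(\<integral>\<^sup>+x. ennreal (norm (?f x - cube_average M k ?f x)) * indicator (dyadic_cube k j) x \<partial>M)
        = (\<integral>\<^sup>+x. 0 \<partial>M)"
      by (intro nn_integral_cong) (auto simp: indicator_def)
    then show ?thesis by simp
  qed
  then show ?thesis
    unfolding mean_deviation_def by (subst nn_integral_dyadic_split[where k = k]) auto
qed

lemma integrable_indicator_scaleR: "A \<in> sets M \<Longrightarrow> integrable M (\<lambda>x. indicator A x *\<^sub>R c)"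
  by (auto intro!: integrable_scaleR_left simp: emeasure_eq_measure)

text \<open>Dynkin induction from the cubes. A cube of scale \<open>k'\<close> is saturated at every
  scale below \<open>k'\<close>, so its deviation is eventually 0; complements follow by linearity,
  and disjoint unions as L1 limits of finite ones.\<close>

lemma mean_deviation_indicator_tendsto_0:
  assumes "A \<in> sets M"
  shows "((\<lambda>k. mean_deviation M k (\<lambda>x. indicator A x *\<^sub>R c)) \<longlongrightarrow> 0) at_bot"
proof -
  have sat: "((\<lambda>k. mean_deviation M k (\<lambda>x. indicator A x *\<^sub>R c)) \<longlongrightarrow> 0) at_bot"
    if "A \<in> sets M" "\<And>x k. k \<le> k' \<Longrightarrow> x \<in> A \<Longrightarrow> dyadic_cube k (dyadic_index k x) \<subseteq> A"
    for A c and k' :: int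
  proof (rule tendsto_eventually)
    show "\<forall>\<^sub>F k in at_bot. mean_deviation M k (\<lambda>x. indicator A x *\<^sub>R c) = 0"
      using eventually_le_at_bot[of k']
      by eventually_elim (use that in \<open>auto intro!: mean_deviation_indicator_saturated\<close>)
  qed
  have sets_M_eq: "sets M = sigma_sets UNIV (insert {} dyadic_cubes)"
    unfolding sets_M borel_eq_dyadic_cubes by simp
  have "insert {} dyadic_cubes \<subseteq> Pow (UNIV :: (real ^ 'n) set)" by simp
  from Int_stable_dyadic_cubes this assms[unfolded sets_M_eq] show ?thesis
  proof (induction arbitrary: c rule: sigma_sets_induct_disjoint)
    case (basic A)
    then consider "A = {}" | k' j' where "A = dyadic_cube k' j'"
      by (auto simp: dyadic_cubes_def)
    then show ?case
    proof cases
      case 1 then show ?thesis by (intro sat[of _ 0]) auto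
    next
      case 2
      have "dyadic_cube k (dyadic_index k x) \<subseteq> A" if "k \<le> k'" "x \<in> A" for x k
        using dyadic_cube_nested[OF that(1), of x] that(2) by (simp add: 2 mem_dyadic_cube_iff)
      then show ?thesis by (intro sat[of _ k']) (auto simp: 2)
    qed
  next
    case empty show ?case by (intro sat[of _ 0]) auto
  next
    case (compl A)
    have A: "A \<in> sets M" using compl.hyps by (simp only: sets_M_eq)
    \<comment> \<open>Writing the difference as a sum calls for the induction hypothesis at
      \<open>- c\<close>, which is why \<open>c\<close> is generalised.\<close>
    have "(\<lambda>x. indicator (UNIV - A) x *\<^sub>R c) = (\<lambda>x. indicator UNIV x *\<^sub>R c + indicator A x *\<^sub>R (- c))"
      by (auto simp: indicator_def)
    moreover have "((\<lambda>k. mean_deviation M k (\<lambda>x. indicator UNIV x *\<^sub>R c)) \<longlongrightarrow> 0) at_bot"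
      by (intro sat[of _ 0]) auto
    ultimately show ?case
      using compl.IH[of "- c"] A
      by (auto intro!: mean_deviation_tendsto_add integrable_indicator_scaleR simp del: scaleR_minus_right)
  next
    case (union A)
    have A: "A i \<in> sets M" for i using union.hyps(2) by (auto simp only: sets_M_eq)
    have U: "(\<Union>i<n. A i) \<in> sets M" for n :: nat using A by auto
    have dev: "((\<lambda>k. mean_deviation M k (\<lambda>x. indicator (\<Union>i<n. A i) x *\<^sub>R c)) \<longlongrightarrow> 0) at_bot" for n :: nat
    proof (induction n)
      case 0 show ?case by (intro sat[of _ 0]) auto
    next
      case (Suc n)
      have "A n \<inter> A i = {}" if "i < n" for i
        using disjoint_family_onD[OF union.hyps(1), of n i] that by simp
      then have "A n \<inter> (\<Union>i<n. A i) = {}" by blast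
      then have "(\<lambda>x. indicator (\<Union>i<Suc n. A i) x *\<^sub>R c) =
          (\<lambda>x. indicator (\<Union>i<n. A i) x *\<^sub>R c + indicator (A n) x *\<^sub>R c)"
        by (auto simp: indicator_def lessThan_Suc fun_eq_iff)
      then show ?case
        using Suc union.IH[of n c] A U
        by (auto intro!: mean_deviation_tendsto_add integrable_indicator_scaleR)
    qed
    show ?case
    proof (rule mean_deviation_tendsto_limit[OF _ _ _ dev])
      show "(\<lambda>n. \<integral>\<^sup>+x. norm (indicator (\<Union>i. A i) x *\<^sub>R c - indicator (\<Union>i<n. A i) x *\<^sub>R c) \<partial>M) \<longlonglongrightarrow> 0"
      proof (rule nn_integral_dominated_convergence_norm[where w = "\<lambda>_. norm c"])
        show "AE x in M. (\<lambda>n. indicator (\<Union>i<n. A i) x *\<^sub>R c) \<longlonglongrightarrow> indicator (\<Union>i. A i) x *\<^sub>R c"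
          by (intro AE_I2 tendsto_scaleR LIMSEQ_indicator_UN tendsto_const)
      qed (use A in \<open>auto simp: indicator_def emeasure_eq_measure ennreal_mult_less_top\<close>)
    qed (use A in \<open>auto intro!: integrable_indicator_scaleR\<close>)
  qed
qed

text \<open>Indicators are settled, sums follow by subadditivity, and the approximating functions of
  \<open>integrable_induct\<close> converge in L1 because they are dominated by
  \<open>2 * norm (f x)\<close>.\<close>

proposition mean_deviation_tendsto_0:
  assumes "integrable M f"
  shows "((\<lambda>k. mean_deviation M k f) \<longlongrightarrow> 0) at_bot"
  using assms
proof (induction rule: integrable_induct)
  case (base A c)
  then show ?case by (intro mean_deviation_indicator_tendsto_0)
next
  case (add f g)
  then show ?case by (intro mean_deviation_tendsto_add)
next
  case (lim f s)
  show ?case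
  proof (rule mean_deviation_tendsto_limit)
    show "(\<lambda>n. \<integral>\<^sup>+x. norm (f x - s n x) \<partial>M) \<longlonglongrightarrow> 0"
    proof (rule nn_integral_dominated_convergence_norm[where w = "\<lambda>x. 2 * norm (f x)"])
      have "integrable M (\<lambda>x. 2 * norm (f x))" using lim by simp
      then show "(\<integral>\<^sup>+x. 2 * norm (f x) \<partial>M) < \<infinity>"
        by (simp only: integrable_iff_bounded real_norm_def abs_mult abs_norm_cancel abs_numeral)
    qed (use lim in auto)
  qed (use lim in auto)
qed

end

subsection \<open>Level sums and critical scales\<close>

text \<open>Tonelli works with integrals over \<open>count_space\<close>, whereas
  \<open>level_sum\<close> is an \<open>infsum\<close>; bounding the latter from below requires this
  direction.\<close>

lemma nn_integral_count_space_le_infsum: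
  fixes f :: "'a \<Rightarrow> ennreal"
  assumes "countable A"
  shows "(\<integral>\<^sup>+x. f x \<partial>count_space A) \<le> infsum f A"
proof (cases "finite A")
  case True
  then show ?thesis by (simp add: nn_integral_count_space_finite)
next
  case False
  let ?g = "from_nat_into A"
  have g: "bij_betw ?g UNIV A"
    using bij_betw_from_nat_into[OF assms False] .
  have "(\<integral>\<^sup>+x. f x \<partial>count_space A) = (\<Sum>n. f (?g n))"
    by (simp add: nn_integral_count_space_nat flip: nn_integral_bij_count_space[OF g])
  also have "\<dots> = (SUP n. \<Sum>i<n. f (?g i))"
    by (rule suminf_eq_SUP)
  also have "\<dots> \<le> (SUP X\<in>{X. finite X \<and> X \<subseteq> A}. sum f X)"
  proof (rule SUP_least)
    fix n
    have "(\<Sum>i<n. f (?g i)) = sum f (?g ` {..<n})"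
      using g by (subst sum.reindex) (auto simp: bij_betw_def intro: inj_on_subset)
    also have "\<dots> \<le> (SUP X\<in>{X. finite X \<and> X \<subseteq> A}. sum f X)"
      using g by (intro SUP_upper) (auto simp: bij_betw_def)
    finally show "(\<Sum>i<n. f (?g i)) \<le> (SUP X\<in>{X. finite X \<and> X \<subseteq> A}. sum f X)" .
  qed
  also have "\<dots> = infsum f A"
    by (rule nonneg_infsum_complete[symmetric]) simp
  finally show ?thesis .
qed

text \<open>Since \<open>emeasure \<mu> Q\<close> is the integral of the indicator of
  \<open>Q\<close>, integrating this function recovers the level sum, which can thus be bounded from
  below pointwise.\<close>

definition level_density ::
    "real \<Rightarrow> ((real ^ 'n) set \<Rightarrow> complex) \<Rightarrow> real \<Rightarrow> real ^ 'n \<Rightarrow> ennreal" where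
  "level_density \<gamma> a t x =
     (\<integral>\<^sup>+Q. ennreal (sidelength Q powr (- \<gamma>)) * indicator Q x \<partial>count_space {Q \<in> dyadic_cubes. norm (a Q) > t})"

lemma dyadic_cubes_borel: "Q \<in> dyadic_cubes \<Longrightarrow> Q \<in> sets borel"
  by (auto simp: dyadic_cubes_def)

lemma
  fixes \<mu> :: "(real ^ 'n) measure"
  assumes [measurable_cong]: "sets \<mu> = sets borel"
  shows borel_measurable_level_density: "level_density \<gamma> a t \<in> borel_measurable \<mu>"
    and nn_integral_level_density_le: "(\<integral>\<^sup>+x. level_density \<gamma> a t x \<partial>\<mu>) \<le> level_sum \<gamma> \<mu> a t"
proof -
  let ?L = "{Q \<in> dyadic_cubes. norm (a Q) > t}"
  have count: "countable ?L"
    by (rule countable_subset[OF _ countable_dyadic_cubes]) auto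
  have borel: "Q \<in> sets borel" if "Q \<in> ?L" for Q using that dyadic_cubes_borel by auto
  have meas: "(\<lambda>x. ennreal (sidelength Q powr (- \<gamma>)) * indicator Q x) \<in> borel_measurable \<mu>" if "Q \<in> ?L" for Q
    using borel[OF that] by measurable
  have "(\<lambda>z. ennreal (sidelength Q powr (- \<gamma>)) * indicator Q (fst z))
      \<in> borel_measurable (\<mu> \<Otimes>\<^sub>M count_space ?L)" if "Q \<in> ?L" for Q
    by (rule measurable_compose[OF measurable_fst meas[OF that]])
  then have "(\<lambda>(x, Q). ennreal (sidelength Q powr (- \<gamma>)) * indicator Q x)
      \<in> borel_measurable (\<mu> \<Otimes>\<^sub>M count_space ?L)"
    unfolding case_prod_unfold
    by (rule measurable_compose_countable'[OF _ measurable_snd count])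
  then show "level_density \<gamma> a t \<in> borel_measurable \<mu>"
    unfolding level_density_def
    by (rule sigma_finite_measure.borel_measurable_nn_integral
        [OF sigma_finite_measure_count_space_countable[OF count]])
  have "(\<integral>\<^sup>+x. level_density \<gamma> a t x \<partial>\<mu>) =
      (\<integral>\<^sup>+Q. (\<integral>\<^sup>+x. ennreal (sidelength Q powr (- \<gamma>)) * indicator Q x \<partial>\<mu>) \<partial>count_space ?L)"
    unfolding level_density_def by (rule nn_integral_count_space_nn_integral[OF count meas])
  also have "\<dots> = (\<integral>\<^sup>+Q. ennreal (sidelength Q powr (- \<gamma>)) * emeasure \<mu> Q \<partial>count_space ?L)"
    by (rule nn_integral_cong, rule nn_integral_cmult_indicator) (simp add: assms dyadic_cubes_borel)
  also have "\<dots> \<le> level_sum \<gamma> \<mu> a t"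
    unfolding level_sum_def by (rule nn_integral_count_space_le_infsum[OF count])
  finally show "(\<integral>\<^sup>+x. level_density \<gamma> a t x \<partial>\<mu>) \<le> level_sum \<gamma> \<mu> a t" .
qed

lemma level_density_ge:
  assumes "norm (a (dyadic_cube k (dyadic_index k x))) > t"
  shows "ennreal ((2 powi k) powr (- \<gamma>)) \<le> level_density \<gamma> a t x"
proof -
  let ?Q = "dyadic_cube k (dyadic_index k x)"
  have "ennreal (sidelength ?Q powr (- \<gamma>)) * indicator ?Q x \<le> level_density \<gamma> a t x"
    unfolding level_density_def
    by (rule nn_integral_ge_point) (use assms in \<open>auto simp: dyadic_cubes_def\<close>)
  then show ?thesis
    by (simp add: sidelength_dyadic_cube mem_dyadic_cube_iff)
qed

lemma norm_dyadic_average_seq: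
  assumes "emeasure \<mu> (dyadic_cube k (dyadic_index k x)) < \<infinity>"
  shows "norm (dyadic_average_seq p \<gamma> \<mu> f (dyadic_cube k (dyadic_index k x))) =
           (2 powi k) powr (\<gamma> / p) * norm (cube_average \<mu> k f x)"
proof (cases "emeasure \<mu> (dyadic_cube k (dyadic_index k x)) = 0")
  case True
  then show ?thesis
    by (simp add: dyadic_average_seq_def cube_average_def measure_def)
next
  case False
  then show ?thesis
    by (simp add: dyadic_average_seq_def cube_average_def sidelength_dyadic_cube norm_mult norm_divide
        zero_less_iff_neq_zero)
qed

lemma exists_int_multiple_in_interval:
  fixes s v :: real
  assumes "s \<noteq> 0"
  obtains k :: int where "v < of_int k * s" "of_int k * s \<le> v + \<bar>s\<bar>"
proof (cases "s > 0")
  case True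
  have "v / s < of_int (\<lfloor>v / s\<rfloor> + 1)" "of_int (\<lfloor>v / s\<rfloor> + 1) \<le> v / s + 1"
    by linarith+
  with True have "v < of_int (\<lfloor>v / s\<rfloor> + 1) * s" "of_int (\<lfloor>v / s\<rfloor> + 1) * s \<le> v + \<bar>s\<bar>"
    by (simp_all add: field_simps)
  then show ?thesis using that by blast
next
  case False
  with assms have "s < 0" by simp
  \<comment> \<open>Division by the negative \<open>s\<close> reverses the inequalities, so
    \<open>k\<close> is the largest integer strictly below \<open>v / s\<close>.\<close>
  define k where "k = \<lceil>v / s\<rceil> - 1"
  have "of_int k < v / s" "v / s \<le> of_int k + 1"
    unfolding k_def by linarith+
  then have "v < of_int k * s" "(of_int k + 1) * s \<le> v"
    using \<open>s < 0\<close> by (simp_all only: neg_less_divide_eq neg_divide_le_eq)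
  moreover from this have "of_int k * s \<le> v + \<bar>s\<bar>"
    using \<open>s < 0\<close> by (simp add: distrib_right)
  ultimately
  show ?thesis using that by blast
qed

text \<open>With \<open>s = \<gamma> / p\<close>, the first claim is the lower bound on
  \<open>2 powr (k * s)\<close> and the second is its upper bound raised to the power
  \<open>- p\<close>. The third takes logarithms, where \<open>log 2 y\<close> is at most
  \<open>log 2 N\<close> in absolute value; its bound is free of \<open>t\<close> and
  \<open>y\<close>.\<close>

lemma exists_critical_level:
  fixes p \<gamma> t y N :: real
  assumes p: "p \<ge> 1" and \<gamma>: "\<gamma> \<noteq> 0" and t: "t > 0" and y: "1 / N \<le> y" "y \<le> N" and N: "N \<ge> 1"
  obtains k :: int where
    "t < (2 powi k) powr (\<gamma> / p) * (y / 2)"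
    "(2 * 2 powr \<bar>\<gamma> / p\<bar>) powr (- p) * y powr p \<le> t powr p * (2 powi k) powr (- \<gamma>)"
    "\<bar>k - \<lfloor>log 2 t / (\<gamma> / p)\<rfloor>\<bar> \<le> \<lceil>(1 + log 2 N + \<bar>\<gamma> / p\<bar>) / \<bar>\<gamma> / p\<bar>\<rceil> + 1"
proof -
  define s where "s = \<gamma> / p"
  have s: "s \<noteq> 0" and \<gamma>_eq: "\<gamma> = s * p" using p \<gamma> by (auto simp: s_def)
  have "y > 0" using y N by (smt (verit) divide_pos_pos)
  define v where "v = log 2 (2 * t / y)"
  have v: "2 powr v = 2 * t / y" using t \<open>y > 0\<close> by (simp add: v_def)
  obtain k :: int where k: "v < of_int k * s" "of_int k * s \<le> v + \<bar>s\<bar>"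
    using exists_int_multiple_in_interval[OF s] .
  have pow: "(2 powi k) powr r = 2 powr (of_int k * r)" for r :: real
    by (simp flip: powr_real_of_int' add: powr_powr)
  show ?thesis
  proof (rule that)
    have "2 * t / y < 2 powr (of_int k * s)" using k(1) by (simp flip: v)
    then show "t < (2 powi k) powr (\<gamma> / p) * (y / 2)"
      using \<open>y > 0\<close> by (simp add: pow field_simps flip: s_def)
    have "2 powr (of_int k * s) \<le> 2 powr (v + \<bar>s\<bar>)"
      using k(2) by simp
    then have "(2 powr (v + \<bar>s\<bar>)) powr (- p) \<le> (2 powr (of_int k * s)) powr (- p)"
      using p by (intro powr_mono2') auto
    also have "\<dots> = (2 powi k) powr (- \<gamma>)"
      by (simp add: pow powr_powr \<gamma>_eq algebra_simps)
    also have "2 powr (v + \<bar>s\<bar>) = 2 * 2 powr \<bar>s\<bar> * (t / y)"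
      by (simp add: powr_add v)
    finally have "t powr p * (2 * 2 powr \<bar>s\<bar> * (t / y)) powr (- p) \<le> t powr p * (2 powi k) powr (- \<gamma>)"
      by (rule mult_left_mono) simp
    moreover have "t powr p * (2 * 2 powr \<bar>s\<bar> * (t / y)) powr (- p) =
        (2 * 2 powr \<bar>s\<bar>) powr (- p) * y powr p"
      using t \<open>y > 0\<close> by (simp add: powr_mult powr_divide powr_minus field_simps)
    ultimately show "(2 * 2 powr \<bar>\<gamma> / p\<bar>) powr (- p) * y powr p \<le> t powr p * (2 powi k) powr (- \<gamma>)"
      by (simp flip: s_def)
    have "v = 1 + log 2 t - log 2 y"
      using t \<open>y > 0\<close> by (simp add: v_def log_mult log_divide)
    moreover have "log 2 y \<le> log 2 N" using y \<open>y > 0\<close> by simp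
    moreover have "- log 2 N \<le> log 2 y"
    proof -
      have "log 2 (1 / N) \<le> log 2 y" using y \<open>y > 0\<close> N by (subst log_le_cancel_iff) auto
      then show ?thesis using N by (simp add: log_divide)
    qed
    ultimately have "\<bar>of_int k * s - log 2 t\<bar> \<le> 1 + log 2 N + \<bar>s\<bar>"
      using k by linarith
    then have "\<bar>of_int k * s - log 2 t\<bar> / \<bar>s\<bar> \<le> (1 + log 2 N + \<bar>s\<bar>) / \<bar>s\<bar>"
      using s by (intro divide_right_mono) auto
    also have "\<bar>of_int k * s - log 2 t\<bar> / \<bar>s\<bar> = \<bar>of_int k - log 2 t / s\<bar>"
      using s by (simp flip: abs_divide add: diff_divide_distrib)
    \<comment> \<open>The ceiling and the extra 1 absorb the rounding of
      \<open>log 2 t / s\<close>.\<close>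
    finally show "\<bar>k - \<lfloor>log 2 t / (\<gamma> / p)\<rfloor>\<bar> \<le> \<lceil>(1 + log 2 N + \<bar>\<gamma> / p\<bar>) / \<bar>\<gamma> / p\<bar>\<rceil> + 1"
      unfolding s_def[symmetric] by linarith
  qed
qed

section \<open>Passing to the limit in the level, and taking roots\<close>

lemma le_Liminf_if_le_add:
  fixes G e :: "'a \<Rightarrow> ennreal"
  assumes "F \<noteq> bot" "c \<noteq> \<infinity>" "\<forall>\<^sub>F t in F. c \<le> G t + e t" "(e \<longlongrightarrow> 0) F"
  shows "c \<le> Liminf F G"
proof -
  \<comment> \<open>As \<open>c\<close> is finite, truncated subtraction moves the error to the left
    side and is continuous there.\<close>
  have "((\<lambda>t. c - e t) \<longlongrightarrow> c - 0) F"
    using assms by (intro tendsto_diff_ennreal) auto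
  then have "Liminf F (\<lambda>t. c - e t) = c"
    using lim_imp_Liminf assms(1) by fastforce
  moreover have "Liminf F (\<lambda>t. c - e t) \<le> Liminf F G"
    using assms(3) by (intro Liminf_mono) (auto elim!: eventually_mono simp: ennreal_minus_le_iff add.commute assms(2)[simplified])
  ultimately show ?thesis by simp
qed

lemma ennreal_powr_mono_scaled:
  assumes "c > 0" "r > 0" "ennreal c * x \<le> y"
  shows "ennreal_powr x r \<le> ennreal (c powr (- r)) * ennreal_powr y r"
proof (cases "y = \<infinity>")
  case True
  then show ?thesis using assms by (simp add: ennreal_powr_def ennreal_mult_top)
next
  case False
  then obtain y' where y: "y = ennreal y'" "y' \<ge> 0" by (cases y) auto
  have "x \<noteq> \<infinity>" using assms False by (auto simp: ennreal_mult_top top_unique)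
  then obtain x' where x: "x = ennreal x'" "x' \<ge> 0" by (cases x) auto
  have "c * x' \<le> y'" using assms x y by (simp flip: ennreal_mult)
  then have "x' \<le> y' / c" using assms by (simp add: field_simps)
  then have "x' powr r \<le> (y' / c) powr r" using assms x by (intro powr_mono2) auto
  also have "\<dots> = c powr (- r) * y' powr r"
    using assms y by (simp add: powr_divide powr_minus field_simps)
  finally show ?thesis
    using x y by (simp add: ennreal_powr_def flip: ennreal_mult)
qed

text \<open>The logarithm tends to minus infinity at 0 and to infinity at infinity; the sign of
  \<open>s\<close> matches the filter, so the critical cubes shrink in both cases.\<close>

lemma filterlim_floor_log_at_bot:
  fixes s :: real
  assumes "s \<noteq> 0"
  shows "filterlim (\<lambda>t. \<lfloor>log 2 t / s\<rfloor>) at_bot (if s > 0 then at_right 0 else at_top)"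
  unfolding filterlim_at_bot
proof
  fix Z :: int
  show "\<forall>\<^sub>F t in if s > 0 then at_right 0 else at_top. \<lfloor>log 2 t / s\<rfloor> \<le> Z"
  proof (cases "s > 0")
    case True
    have "\<forall>\<^sub>F t in at_right 0. t \<in> {0 <..< 2 powr (of_int Z * s)}"
      by (rule eventually_at_right_real) simp
    then have "\<forall>\<^sub>F t in at_right 0. \<lfloor>log 2 t / s\<rfloor> \<le> Z"
    proof eventually_elim
      case (elim t)
      then have "log 2 t \<le> of_int Z * s" by (subst log_le_iff) auto
      then have "log 2 t / s \<le> of_int Z" using True by (simp add: field_simps)
      then show ?case by linarith
    qed
    then show ?thesis using True by simp
  next
    case False
    have "\<forall>\<^sub>F t in at_top. t \<ge> 2 powr (of_int Z * s)"
      by (rule eventually_ge_at_top)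
    then have "\<forall>\<^sub>F t in at_top. \<lfloor>log 2 t / s\<rfloor> \<le> Z"
    proof eventually_elim
      case (elim t)
      then have "of_int Z * s \<le> log 2 t" 
        by (subst le_log_iff) (auto intro: less_le_trans[of 0 "2 powr (of_int Z * s)"])
      then have "log 2 t / s \<le> of_int Z" using False assms by (simp add: field_simps)
      then show ?case by linarith
    qed
    then show ?thesis using False by simp
  qed
qed

subsection \<open>Truncation to bounded regions\<close>

text \<open>A union of unit dyadic cubes instead of a ball: every cube of scale at most 0 that meets
  it lies inside it.\<close>

definition dyadic_box :: "nat \<Rightarrow> (real ^ 'n) set" where
  "dyadic_box N = {x. \<forall>i. \<bar>dyadic_index 0 x $ i\<bar> \<le> int N}"

lemma dyadic_box_measurable [measurable]: "(dyadic_box N :: (real ^ 'n) set) \<in> sets borel"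
proof -
  have "dyadic_index 0 -` {j :: int ^ 'n. \<forall>i. \<bar>j $ i\<bar> \<le> int N} \<inter> space borel \<in> sets borel"
    by (rule measurable_sets[OF measurable_dyadic_index]) auto
  then show ?thesis by (simp add: dyadic_box_def vimage_def)
qed

text \<open>Compactness of the \<open>cbox\<close> gives the box finite measure and makes
  \<open>f\<close> integrable on it. The unit interval with index \<open>N\<close> reaches up to
  \<open>N + 1\<close>.\<close>

lemma dyadic_box_subset_cbox:
  "dyadic_box N \<subseteq> cbox (\<chi> i. - real N) (\<chi> i. real N + 1 :: real ^ 'n)"
proof
  fix x :: "real ^ 'n" assume "x \<in> dyadic_box N"
  then have "\<bar>\<lfloor>x $ i\<rfloor>\<bar> \<le> int N" for i by (simp add: dyadic_box_def dyadic_index_def)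
  then have "- int N \<le> \<lfloor>x $ i\<rfloor>" "\<lfloor>x $ i\<rfloor> \<le> int N" for i
    by (simp_all add: abs_le_iff minus_le_iff)
  then have "- real N \<le> x $ i \<and> x $ i \<le> real N + 1" for i
    using floor_le_iff[of "x $ i" "int N"] by (fastforce simp: le_floor_iff)
  then show "x \<in> cbox (\<chi> i. - real N) (\<chi> i. real N + 1)" by (simp add: mem_box_cart)
qed

lemma dyadic_cube_subset_dyadic_box:
  assumes "k \<le> 0" "x \<in> dyadic_box N"
  shows "dyadic_cube k (dyadic_index k x) \<subseteq> dyadic_box N"
proof
  fix y assume "y \<in> dyadic_cube k (dyadic_index k x)"
  then have "dyadic_index 0 y = dyadic_index 0 x"
    using dyadic_index_mono[OF _ assms(1)] by (simp add: mem_dyadic_cube_iff)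
  then show "y \<in> dyadic_box N" using assms(2) by (simp add: dyadic_box_def)
qed

lemma dyadic_box_mono: "N \<le> N' \<Longrightarrow> dyadic_box N \<subseteq> dyadic_box N'"
  by (auto simp: dyadic_box_def intro: order_trans)

lemma UN_dyadic_box: "(\<Union>N. dyadic_box N) = UNIV"
proof -
  have "\<exists>N. x \<in> dyadic_box N" for x :: "real ^ 'n"
  proof
    let ?N = "nat (Max (range (\<lambda>i. \<bar>dyadic_index 0 x $ i\<bar>)))"
    have "\<bar>dyadic_index 0 x $ i\<bar> \<le> Max (range (\<lambda>i. \<bar>dyadic_index 0 x $ i\<bar>))" for i
      by (rule Max_ge) auto
    also have "\<dots> \<le> int ?N" by linarith
    finally show "x \<in> dyadic_box ?N"
      unfolding dyadic_box_def by blast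
  qed
  then show ?thesis by blast
qed

text \<open>The truncation to \<open>A\<close> makes the integral finite and keeps the critical
  scales at bounded distance from one scale that depends only on \<open>t\<close>. The constant is
  that of \<open>exists_critical_level\<close>.\<close>

lemma truncated_Lp_le_Liminf:
  fixes \<mu> :: "(real ^ 'n) measure" and p \<gamma> :: real and N :: nat
  assumes radon: "radon_measure \<mu>" and p: "p \<ge> 1" and \<gamma>: "\<gamma> \<noteq> 0" and f: "f \<in> L1_loc \<mu>" and N: "N \<ge> 1"
  defines "A \<equiv> {x \<in> dyadic_box N. 1 / N \<le> norm (f x) \<and> norm (f x) \<le> N}"
  shows "ennreal ((2 * 2 powr \<bar>\<gamma> / p\<bar>) powr (- p)) * (\<integral>\<^sup>+x. ennreal (norm (f x) powr p) * indicator A x \<partial>\<mu>)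
      \<le> Liminf (if \<gamma> > 0 then at_right 0 else at_top)
          (\<lambda>t. ennreal (t powr p) * level_sum \<gamma> \<mu> (dyadic_average_seq p \<gamma> \<mu> f) t)"
    (is "ennreal ?c * ?I \<le> Liminf ?F ?G")
proof -
  have sets_\<mu> [measurable_cong, simp]: "sets \<mu> = sets borel"
    using radon by (simp add: radon_measure_def)
  have space_\<mu> [simp]: "space \<mu> = UNIV"
    using sets_eq_imp_space_eq[OF sets_\<mu>] by simp
  let ?R = "dyadic_box N :: (real ^ 'n) set"
  let ?K = "cbox (\<chi> i. - real N) (\<chi> i. real N + 1) :: (real ^ 'n) set"
  let ?a = "dyadic_average_seq p \<gamma> \<mu> f"
  have f_meas [measurable]: "f \<in> borel_measurable \<mu>"
    and f_int: "set_integrable \<mu> ?K f"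
    using f by (auto simp: L1_loc_def)
  have A_meas [measurable]: "A \<in> sets borel"
  proof -
    have "A = {x \<in> space \<mu>. x \<in> ?R \<and> 1 / N \<le> norm (f x) \<and> norm (f x) \<le> N}"
      by (auto simp: A_def)
    also have "\<dots> \<in> sets \<mu>" by measurable
    finally show ?thesis by simp
  qed
  have "emeasure \<mu> ?R \<le> emeasure \<mu> ?K"
    by (intro emeasure_mono dyadic_box_subset_cbox) auto
  also have "\<dots> < \<infinity>"
    using radon compact_cbox unfolding radon_measure_def by blast
  finally have R_fin: "emeasure \<mu> ?R < \<infinity>" .

  \<comment> \<open>Convergence in the mean is applied to this finite restriction of
    \<open>\<mu>\<close>. At points of the box and scales at most 0 it has the same averages as
    \<open>\<mu>\<close>.\<close>
  define M where "M = density \<mu> (\<lambda>x. ennreal (indicator ?R x))"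
  have M_eq: "emeasure M B = emeasure \<mu> (?R \<inter> B)" if "B \<in> sets borel" for B
  proof -
    have "emeasure M B = (\<integral>\<^sup>+x. ennreal (indicator ?R x) * indicator B x \<partial>\<mu>)"
      unfolding M_def using that by (intro emeasure_density) auto
    also have "\<dots> = (\<integral>\<^sup>+x. indicator (?R \<inter> B) x \<partial>\<mu>)"
      by (intro nn_integral_cong) (auto simp: indicator_def)
    also have "\<dots> = emeasure \<mu> (?R \<inter> B)"
      using that by (intro nn_integral_indicator) auto
    finally show ?thesis .
  qed
  have nn_integral_M: "(\<integral>\<^sup>+x. h x \<partial>M) = (\<integral>\<^sup>+x. h x * indicator ?R x \<partial>\<mu>)"
    if "h \<in> borel_measurable \<mu>" for h
    unfolding M_def using that
    by (subst nn_integral_density) (auto intro!: nn_integral_cong simp: indicator_def)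
  have "emeasure M (space M) \<noteq> \<infinity>"
    using M_eq[of UNIV] R_fin by (simp add: M_def)
  then interpret M: finite_borel_measure M
    by (intro finite_borel_measure.intro finite_measureI finite_borel_measure_axioms.intro)
      (simp_all add: M_def)
  have int_M: "integrable M f"
  proof -
    have "set_integrable \<mu> ?R f"
      by (rule set_integrable_subset[OF f_int _ dyadic_box_subset_cbox]) simp
    then show ?thesis
      unfolding M_def set_integrable_def by (subst integrable_density) auto
  qed
  have average_M: "cube_average M k f x = cube_average \<mu> k f x"
    and cube_fin: "emeasure \<mu> (dyadic_cube k (dyadic_index k x)) < \<infinity>"
    if "k \<le> 0" "x \<in> ?R" for k x
  proof -
    let ?Q = "dyadic_cube k (dyadic_index k x)"
    have Q: "?Q \<subseteq> ?R" using that by (rule dyadic_cube_subset_dyadic_box)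
    have "emeasure \<mu> ?Q \<le> emeasure \<mu> ?R" using Q by (intro emeasure_mono) auto
    then show "emeasure \<mu> ?Q < \<infinity>" using R_fin by (rule le_less_trans)
    have "?R \<inter> ?Q = ?Q" using Q by blast
    then have "measure M ?Q = measure \<mu> ?Q"
      using M_eq[of ?Q] by (simp add: measure_def)
    moreover have "(LINT y:?Q|M. f y) = (LINT y:?Q|\<mu>. f y)"
      unfolding M_def set_lebesgue_integral_def
      by (subst integral_density) (use Q in \<open>auto intro!: Bochner_Integration.integral_cong simp: indicator_def\<close>)
    ultimately show "cube_average M k f x = cube_average \<mu> k f x"
      by (simp add: cube_average_def)
  qed

  \<comment> \<open>\<open>e t\<close> pays for the points whose critical cube has a small average: there \<open>f\<close> is at distance at least
    \<open>1 / (2 * N)\<close> from its average. \<open>J\<close> bounds the spread of the critical scales around \<open>k0 t\<close>.\<close>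
  define D where "D = ?c * N powr p * (2 * N)"
  define J where "J = \<lceil>(1 + log 2 N + \<bar>\<gamma> / p\<bar>) / \<bar>\<gamma> / p\<bar>\<rceil> + 1"
  define k0 where "k0 t = \<lfloor>log 2 t / (\<gamma> / p)\<rfloor>" for t :: real
  define e where "e t = (\<Sum>j\<in>{-J..J}. ennreal D * mean_deviation M (k0 t + j) f)" for t
  have "D > 0" using N by (simp add: D_def)

  have pointwise: "ennreal ?c * (ennreal (norm (f x) powr p) * indicator A x) \<le>
      ennreal (t powr p) * level_density \<gamma> ?a t x +
      (\<Sum>j\<in>{-J..J}. ennreal D * (ennreal (norm (f x - cube_average M (k0 t + j) f x)) * indicator ?R x))"
    (is "?lhs \<le> ?S + ?E") if t: "t > 0" and k0: "k0 t \<le> - J" for t x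
  proof (cases "x \<in> A")
    case False
    then show ?thesis by simp
  next
    case True
    then have x: "x \<in> ?R" and y: "1 / real N \<le> norm (f x)" "norm (f x) \<le> real N"
      by (auto simp: A_def)
    have lhs: "?lhs = ennreal (?c * norm (f x) powr p)"
      using True by (simp add: ennreal_mult)
    obtain k :: int where k: "t < (2 powi k) powr (\<gamma> / p) * (norm (f x) / 2)"
      "?c * norm (f x) powr p \<le> t powr p * (2 powi k) powr (- \<gamma>)"
      "\<bar>k - k0 t\<bar> \<le> J"
      using exists_critical_level[OF p \<gamma> t y] N unfolding k0_def J_def
      by (metis of_nat_1 of_nat_le_iff)
    \<comment> \<open>This keeps the critical cube inside the box, where averages for
      \<open>M\<close> and \<open>\<mu>\<close> coincide.\<close>
    have "k \<le> 0" using k(3) k0 by linarith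
    show ?thesis
    proof (cases "norm (cube_average \<mu> k f x) > norm (f x) / 2")
      case True
      note k(1)
      also have "(2 powi k) powr (\<gamma> / p) * (norm (f x) / 2) \<le>
          (2 powi k) powr (\<gamma> / p) * norm (cube_average \<mu> k f x)"
        using True by (intro mult_left_mono) auto
      also have "\<dots> = norm (?a (dyadic_cube k (dyadic_index k x)))"
        using norm_dyadic_average_seq[OF cube_fin[OF \<open>k \<le> 0\<close> x]] by simp
      finally have "ennreal ((2 powi k) powr (- \<gamma>)) \<le> level_density \<gamma> ?a t x"
        by (rule level_density_ge)
      then have "ennreal (t powr p) * ennreal ((2 powi k) powr (- \<gamma>)) \<le> ?S"
        by (rule mult_left_mono) simp
      moreover have "?lhs \<le> ennreal (t powr p) * ennreal ((2 powi k) powr (- \<gamma>))"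
        using k(2) unfolding lhs by (simp flip: ennreal_mult)
      ultimately have "?lhs \<le> ?S" by simp
      then show ?thesis by (simp add: add_increasing2)
    next
      case False
      have "norm (f x) \<le> norm (f x - cube_average \<mu> k f x) + norm (cube_average \<mu> k f x)"
        using norm_triangle_ineq[of "f x - cube_average \<mu> k f x" "cube_average \<mu> k f x"] by simp
      with False y(1) have "1 / N \<le> 2 * norm (f x - cube_average \<mu> k f x)" by linarith
      then have dev: "1 \<le> 2 * N * norm (f x - cube_average \<mu> k f x)"
        using N by (simp add: field_simps)
      have "norm (f x) powr p \<le> N powr p"
        using y(2) p by (intro powr_mono2) auto
      \<comment> \<open>This explains \<open>D\<close>: the factor \<open>?c * N powr p\<close>
        bounds the left side, and \<open>2 * N\<close> times the deviation is at least 1.\<close>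
      then have "?c * norm (f x) powr p \<le> ?c * N powr p * 1" by simp
      also have "\<dots> \<le> ?c * N powr p * (2 * N * norm (f x - cube_average \<mu> k f x))"
        using dev by (intro mult_left_mono) auto
      finally have "?c * norm (f x) powr p \<le> D * norm (f x - cube_average M k f x)"
        by (simp add: D_def average_M[OF \<open>k \<le> 0\<close> x] mult.assoc)
      \<comment> \<open>The scale \<open>k\<close> is rewritten to exhibit the summand of
        \<open>?E\<close> with \<open>j = k - k0 t\<close>.\<close>
      then have "?lhs \<le> ennreal D * (ennreal (norm (f x - cube_average M (k0 t + (k - k0 t)) f x)) * indicator ?R x)"
        unfolding lhs using x \<open>D > 0\<close> by (simp flip: ennreal_mult)
      also have "\<dots> \<le> ?E"
        using k(3) by (intro member_le_sum) auto
      finally show ?thesis by (simp add: add_increasing)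
    qed
  qed

  have "ennreal ?c * ?I \<le> ?G t + e t" if "t > 0" "k0 t \<le> - J" for t
  proof -
    note [measurable] = borel_measurable_level_density[OF sets_\<mu>]
    have avg_meas [measurable]: "cube_average M k f \<in> borel_measurable \<mu>" for k
      using M.measurable_cube_average[of k f] by (simp add: M_def)
    have dev: "(\<integral>\<^sup>+x. ennreal (norm (f x - cube_average M k f x)) * indicator ?R x \<partial>\<mu>) = mean_deviation M k f" for k
      unfolding mean_deviation_def by (rule nn_integral_M[symmetric]) measurable
    have "ennreal ?c * ?I = (\<integral>\<^sup>+x. ennreal ?c * (ennreal (norm (f x) powr p) * indicator A x) \<partial>\<mu>)"
      by (rule nn_integral_cmult[symmetric]) measurable
    also have "\<dots> \<le> (\<integral>\<^sup>+x. ennreal (t powr p) * level_density \<gamma> ?a t x +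
      (\<Sum>j\<in>{-J..J}. ennreal D * (ennreal (norm (f x - cube_average M (k0 t + j) f x)) * indicator ?R x)) \<partial>\<mu>)"
      by (intro nn_integral_mono pointwise that)
    also have "\<dots> = ennreal (t powr p) * (\<integral>\<^sup>+x. level_density \<gamma> ?a t x \<partial>\<mu>) + e t"
      by (simp add: nn_integral_add nn_integral_sum nn_integral_cmult dev e_def)
    also have "\<dots> \<le> ?G t + e t"
      by (intro add_right_mono mult_left_mono nn_integral_level_density_le) auto
    finally show ?thesis .
  qed
  note bound = this

  have k0_lim: "filterlim k0 at_bot ?F"
    using filterlim_floor_log_at_bot[of "\<gamma> / p"] p \<gamma> unfolding k0_def[abs_def]
    by (simp add: zero_less_divide_iff)
  have F: "?F \<noteq> bot" by simp
  have pos: "\<forall>\<^sub>F t in ?F. t > 0"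
    by (simp add: eventually_at_right_less eventually_gt_at_top)
  \<comment> \<open>Finiteness is what allows the error to be subtracted in
    \<open>le_Liminf_if_le_add\<close>.\<close>
  have I_fin: "?I < \<infinity>"
  proof -
    have "?I \<le> (\<integral>\<^sup>+x. ennreal (N powr p) * indicator ?R x \<partial>\<mu>)"
      using p by (intro nn_integral_mono) (auto simp: A_def indicator_def intro!: ennreal_leI powr_mono2)
    also have "\<dots> = ennreal (N powr p) * emeasure \<mu> ?R"
      by (rule nn_integral_cmult_indicator) simp
    also have "\<dots> < \<infinity>" using R_fin by (simp add: ennreal_mult_less_top)
    finally show ?thesis .
  qed
  show ?thesis
  proof (rule le_Liminf_if_le_add[OF F])
    show "ennreal ?c * ?I \<noteq> \<infinity>"
      using I_fin by (simp add: ennreal_mult_eq_top_iff)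
    have "\<forall>\<^sub>F t in ?F. k0 t \<le> - J"
      using k0_lim by (simp add: filterlim_at_bot)
    with pos show "\<forall>\<^sub>F t in ?F. ennreal ?c * ?I \<le> ?G t + e t"
      by eventually_elim (rule bound)
    \<comment> \<open>A fixed shift \<open>j\<close> does not affect the limit of the scale, and the
      number of summands of \<open>e t\<close> does not depend on \<open>t\<close>.\<close>
    have "((\<lambda>t. ennreal D * mean_deviation M (k0 t + j) f) \<longlongrightarrow> ennreal D * 0) ?F" for j
    proof (intro ennreal_tendsto_cmult)
      have "filterlim (\<lambda>t. k0 t + j) at_bot ?F"
        unfolding filterlim_at_bot
      proof
        fix Z
        have "\<forall>\<^sub>F t in ?F. k0 t \<le> Z - j" using k0_lim by (simp add: filterlim_at_bot)
        then show "\<forall>\<^sub>F t in ?F. k0 t + j \<le> Z" by eventually_elim simp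
      qed
      then show "((\<lambda>t. mean_deviation M (k0 t + j) f) \<longlongrightarrow> 0) ?F"
        by (rule filterlim_compose[OF M.mean_deviation_tendsto_0[OF int_M]])
    qed simp
    then have "(e \<longlongrightarrow> (\<Sum>j\<in>{-J..J}. ennreal D * 0)) ?F"
      unfolding e_def[abs_def] by (rule tendsto_sum)
    then show "(e \<longlongrightarrow> 0) ?F" by simp
  qed
qed

section \<open>Exhausting the space by truncated regions\<close>

theorem theorem5p1:
  fixes \<mu> :: "(real ^ 'n) measure" and p \<gamma> :: real
  assumes "radon_measure \<mu>"
    and "1 \<le> p"
    and "\<gamma> > 0 \<or> (\<gamma> < 0 \<and> doubling_measure \<mu>)"
  shows "\<exists>C::real. C > 0 \<and>
           (\<forall>f\<in>L1_loc \<mu>.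
              Lp_norm p \<mu> f \<le> ennreal C * weak_lp_limit p \<gamma> \<mu> (dyadic_average_seq p \<gamma> \<mu> f))"
proof -
  let ?c = "(2 * 2 powr \<bar>\<gamma> / p\<bar>) powr (- p)"
  have \<gamma>: "\<gamma> \<noteq> 0" using assms(3) by auto
  have sets_\<mu> [measurable_cong]: "sets \<mu> = sets borel"
    using assms(1) by (simp add: radon_measure_def)
  \<comment> \<open>The constant simplifies to
    \<open>2 * 2 powr \<bar>\<gamma> / p\<bar>\<close>.\<close>
  have "Lp_norm p \<mu> f \<le> ennreal (?c powr (- (1 / p))) * weak_lp_limit p \<gamma> \<mu> (dyadic_average_seq p \<gamma> \<mu> f)"
    if f: "f \<in> L1_loc \<mu>" for f
  proof -
    define G where "G t = ennreal (t powr p) * level_sum \<gamma> \<mu> (dyadic_average_seq p \<gamma> \<mu> f) t" for t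
    define L where "L = (if \<gamma> > 0 then Liminf (at_right 0) G else Limsup at_top G)"
    define A where "A n = {x \<in> dyadic_box (Suc n). 1 / Suc n \<le> norm (f x) \<and> norm (f x) \<le> Suc n}" for n
    have f_meas [measurable]: "f \<in> borel_measurable \<mu>" using f by (simp add: L1_loc_def)
    have A_meas [measurable]: "A n \<in> sets \<mu>" for n
    proof -
      have "A n = {x \<in> space \<mu>. x \<in> dyadic_box (Suc n) \<and> 1 / Suc n \<le> norm (f x) \<and> norm (f x) \<le> Suc n}"
        using sets_eq_imp_space_eq[OF sets_\<mu>] by (auto simp: A_def)
      also have "\<dots> \<in> sets \<mu>" by measurable
      finally show ?thesis .
    qed
    have A_mono: "A m \<subseteq> A n" if "m \<le> n" for m n
    proof -
      have "1 / real (Suc n) \<le> 1 / real (Suc m)" using that by (simp add: field_simps)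
      moreover have "real (Suc m) \<le> real (Suc n)" using that by simp
      ultimately show ?thesis
        using dyadic_box_mono[of "Suc m" "Suc n"] that unfolding A_def
        by (auto simp del: of_nat_Suc intro: order_trans)
    qed
    \<comment> \<open>Where \<open>f\<close> vanishes the left side is 0; any other point lies in
      \<open>A n\<close> once \<open>n\<close> exceeds its box index, \<open>norm (f x)\<close> and
      the reciprocal of \<open>norm (f x)\<close>.\<close>
    have le_SUP: "ennreal (norm (f x) powr p) \<le> (SUP n. ennreal (norm (f x) powr p) * indicator (A n) x)" for x
    proof (cases "f x = 0")
      case False
      obtain n1 where n1: "x \<in> dyadic_box n1" using UN_dyadic_box by blast
      obtain n2 :: nat where n2: "norm (f x) \<le> n2" using real_arch_simple by blast
      obtain n3 :: nat where n3: "inverse (real (Suc n3)) < norm (f x)"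
        using reals_Archimedean[of "norm (f x)"] False by auto
      define n where "n = max n1 (max n2 n3)"
      have "x \<in> dyadic_box (Suc n)"
        by (rule subsetD[OF dyadic_box_mono n1]) (simp add: n_def)
      moreover have "norm (f x) \<le> Suc n" using n2 by (simp add: n_def)
      moreover have "1 / real (Suc n) \<le> 1 / real (Suc n3)"
        by (intro divide_left_mono) (auto simp: n_def)
      ultimately have "x \<in> A n" using n3 by (simp add: A_def inverse_eq_divide)
      then show ?thesis by (intro SUP_upper2[of n]) auto
    qed simp
    \<comment> \<open>For negative \<open>\<gamma>\<close> the quantity \<open>L\<close> is an upper
      limit, which dominates the lower limit at infinity.\<close>
    have "Liminf (if \<gamma> > 0 then at_right 0 else at_top) G \<le> L"
      by (simp add: L_def Liminf_le_Limsup)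
    then have bound: "ennreal ?c * (\<integral>\<^sup>+x. ennreal (norm (f x) powr p) * indicator (A n) x \<partial>\<mu>) \<le> L" for n
      using truncated_Lp_le_Liminf[OF assms(1,2) \<gamma> f, of "Suc n"]
      by (simp add: A_def G_def[abs_def])
    have "ennreal ?c * (\<integral>\<^sup>+x. ennreal (norm (f x) powr p) \<partial>\<mu>)
        \<le> ennreal ?c * (\<integral>\<^sup>+x. (SUP n. ennreal (norm (f x) powr p) * indicator (A n) x) \<partial>\<mu>)"
      by (intro mult_left_mono nn_integral_mono le_SUP) simp
    also have "\<dots> = ennreal ?c * (SUP n. \<integral>\<^sup>+x. ennreal (norm (f x) powr p) * indicator (A n) x \<partial>\<mu>)"
    proof (subst nn_integral_monotone_convergence_SUP)
      show "incseq (\<lambda>n x. ennreal (norm (f x) powr p) * indicator (A n) x)"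
        using A_mono by (auto simp: incseq_def le_fun_def indicator_def)
    qed auto
    also have "\<dots> = (SUP n. ennreal ?c * (\<integral>\<^sup>+x. ennreal (norm (f x) powr p) * indicator (A n) x \<partial>\<mu>))"
      by (rule SUP_mult_left_ennreal)
    also have "\<dots> \<le> L" by (intro SUP_least bound)
    finally have "Lp_norm p \<mu> f \<le> ennreal (?c powr (- (1 / p))) * ennreal_powr L (1 / p)"
      unfolding Lp_norm_def using assms(2) by (intro ennreal_powr_mono_scaled) auto
    then show ?thesis
      by (simp add: weak_lp_limit_def L_def G_def[abs_def] split: if_splits)
  qed
  moreover have "?c powr (- (1 / p)) > 0" by simp
  ultimately show ?thesis by blast
qed

end
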